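(* Let $H$ be a digraph and let $u,v,w$ (with vertices $s(u),b(u),s(v),b(v),s(w),b(w)$) be a digraph asteroidal triple (DAT) in $H$. Then there exist, for each permutation $x,y,z$ of $u,v,w$, walks $P(x,s(x))$, $P(y,b(x))$, $P(z,b(x))$ as in the definition of a permutable triple, such that all the associated directed walks $P(x;y)$ and $P(x;z)$ in $H^+$ lie entirely inside one fixed strong component $C$ of $H^+$. In particular, the pairs $u,v$; $u,w$; $v,w$ and $s(u),b(u)$; $s(v),b(v)$; $s(w),b(w)$ are all invertible, and the vertices $(u,v),(v,u),(u,w),(w,u),(v,w),(w,v),(s(u),b(u)),(s(v),b(v)),(s(w),b(w))$ of $H^+$ all belong to $C$.
   Context: A digraph $H$ is a finite set $V(H)$ with a binary relation $E(H)$ (arcs). A walk in $H$ is a sequence $x_0,\dots,x_n$ of vertices together with, for each $i$, a designation of step $i$ as forward (requiring $x_ix_{i+1}\in E(H)$) or backward (requiring $x_{i+1}x_i\in E(H)$). Two walks $P=x_0,\dots,x_n$ and $Q=y_0,\dots,y_n$ are congruent if for every $i$ step $i$ of $P$ is forward iff step $i$ of $Q$ is forward. For congruent $P,Q$, $P$ avoids $Q$ if there is no $i$ with step $i$ forward and $x_iy_{i+1}\in E(H)$, and no $i$ with step $i$ backward and $y_{i+1}x_i\in E(H)$. $H^+$ is the digraph with vertex set all ordered pairs $(u,v)$ of vertices of $H$, with an arc from $(u,v)$ to $(u',v')$ if either $uu'\in E(H)$, $vv'\in E(H)$, $uv'\notin E(H)$, or $u'u\in E(H)$, $v'v\in E(H)$,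 $v'u\notin E(H)$. If $P=x_0,\dots,x_n$ and $Q=y_0,\dots,y_n$ are congruent and $P$ avoids $Q$, the sequence $(x_0,y_0),\dots,(x_n,y_n)$ is a directed walk in $H^+$. Two distinct vertices $u,v$ form an invertible pair if there exist congruent walks $P$ from $u$ to $v$ and $Q$ from $v$ to $u$ with $P$ avoiding $Q$, and congruent walks $P'$ from $v$ to $u$ and $Q'$ from $u$ to $v$ with $P'$ avoiding $Q'$. A permutable triple consists of three distinct vertices $u,v,w$ together with six vertices $s(u),b(u),s(v),b(v),s(w),b(w)$ such that for each $x\in\{u,v,w\}$, with $y,z$ the other two, there exist a walk $P(x,s(x))$ from $x$ to $s(x)$ and walks $P(y,b(x))$ from $y$ to $b(x)$ and $P(z,b(x))$ from $z$ to $b(x)$, both congruent to $P(x,s(x))$, such that $P(x,s(x))$ avoids both. The associated walks $P(x;y)$, $P(x;z)$ are the directed walks in $H^+$ from $(x,y)$, resp. $(x,z)$, to $(s(x),b(x))$ formed by pairing $P(x,s(x))$ coordinatewise with $P(y,b(x))$, resp. $P(z,b(x))$. A DAT is a permutable triple in which each pair $s(u),b(u)$; $s(v),b(v)$; $s(w),b(w)$ is invertible. *)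

theory Defs
  imports "Graph_Theory.Graph_Theory"
begin

datatype step = Forward | Backward

text \<open>Vertex sequence and step designations. The latter must be recorded, as a step between
  vertices joined in both directions may be designated either way.\<close>

type_synonym 'a owalk = "'a list \<times> step list"

definition is_step :: "'a pair_pre_digraph \<Rightarrow> step \<Rightarrow> 'a \<Rightarrow> 'a \<Rightarrow> bool" where
  "is_step H d a b \<longleftrightarrow>
     (case d of Forward \<Rightarrow> (a, b) \<in> parcs H | Backward \<Rightarrow> (b, a) \<in> parcs H)"

definition owalk :: "'a pair_pre_digraph \<Rightarrow> 'a owalk \<Rightarrow> bool" where
  "owalk H P \<longleftrightarrow>
     length (fst P) = Suc (length (snd P)) \<and>
     set (fst P) \<subseteq> pverts H \<and>
     (\<forall>i < length (snd P). is_step H (snd P ! i) (fst P ! i) (fst P ! Suc i))"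

definition owalk_from_to :: "'a pair_pre_digraph \<Rightarrow> 'a owalk \<Rightarrow> 'a \<Rightarrow> 'a \<Rightarrow> bool" where
  "owalk_from_to H P a b \<longleftrightarrow> owalk H P \<and> hd (fst P) = a \<and> last (fst P) = b"

definition congruent_walks :: "'a owalk \<Rightarrow> 'a owalk \<Rightarrow> bool" where
  "congruent_walks P Q \<longleftrightarrow> snd P = snd Q"

text \<open>Only meaningful for congruent walks; congruence is always required separately.\<close>

definition avoids :: "'a pair_pre_digraph \<Rightarrow> 'a owalk \<Rightarrow> 'a owalk \<Rightarrow> bool" where
  "avoids H P Q \<longleftrightarrow>
     \<not> (\<exists>i < length (snd P). is_step H (snd P ! i) (fst P ! i) (fst Q ! Suc i))"

definition plus_digraph :: "'a pair_pre_digraph \<Rightarrow> ('a \<times> 'a) pair_pre_digraph" where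
  "plus_digraph H = \<lparr>
     pverts = pverts H \<times> pverts H,
     parcs = {((u, v), (u', v')) | u v u' v'.
       (u, u') \<in> parcs H \<and> (v, v') \<in> parcs H \<and> (u, v') \<notin> parcs H \<or>
       (u', u) \<in> parcs H \<and> (v', v) \<in> parcs H \<and> (v', u) \<notin> parcs H} \<rparr>"

definition invertible_pair :: "'a pair_pre_digraph \<Rightarrow> 'a \<Rightarrow> 'a \<Rightarrow> bool" where
  "invertible_pair H u v \<longleftrightarrow>
     u \<in> pverts H \<and> v \<in> pverts H \<and> u \<noteq> v \<and>
     (\<exists>P Q. owalk_from_to H P u v \<and> owalk_from_to H Q v u \<and>
        congruent_walks P Q \<and> avoids H P Q) \<and>
     (\<exists>P' Q'. owalk_from_to H P' v u \<and> owalk_from_to H Q' u v \<and>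
        congruent_walks P' Q' \<and> avoids H P' Q')"

text \<open>\<open>S x\<close> is the walk $P(x,s(x))$ and \<open>B y x\<close> is the walk $P(y,b(x))$. Only \<open>S x\<close>, \<open>s x\<close>, \<open>b x\<close>
  and \<open>B y x\<close> for distinct \<open>x\<close>, \<open>y\<close> among \<open>u\<close>, \<open>v\<close>, \<open>w\<close> are relevant.\<close>

definition triple_walks ::
  "'a pair_pre_digraph \<Rightarrow> 'a \<Rightarrow> 'a \<Rightarrow> 'a \<Rightarrow> ('a \<Rightarrow> 'a) \<Rightarrow> ('a \<Rightarrow> 'a) \<Rightarrow>
   ('a \<Rightarrow> 'a owalk) \<Rightarrow> ('a \<Rightarrow> 'a \<Rightarrow> 'a owalk) \<Rightarrow> bool" where
  "triple_walks H u v w s b S B \<longleftrightarrow>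
     (\<forall>x \<in> {u, v, w}. owalk_from_to H (S x) x (s x) \<and>
        (\<forall>y \<in> {u, v, w} - {x}. owalk_from_to H (B y x) y (b x) \<and>
           congruent_walks (B y x) (S x) \<and> avoids H (S x) (B y x)))"

definition permutable_triple ::
  "'a pair_pre_digraph \<Rightarrow> 'a \<Rightarrow> 'a \<Rightarrow> 'a \<Rightarrow> ('a \<Rightarrow> 'a) \<Rightarrow> ('a \<Rightarrow> 'a) \<Rightarrow> bool" where
  "permutable_triple H u v w s b \<longleftrightarrow>
     distinct [u, v, w] \<and>
     {u, v, w, s u, b u, s v, b v, s w, b w} \<subseteq> pverts H \<and>
     (\<exists>S B. triple_walks H u v w s b S B)"

definition DAT ::
  "'a pair_pre_digraph \<Rightarrow> 'a \<Rightarrow> 'a \<Rightarrow> 'a \<Rightarrow> ('a \<Rightarrow> 'a) \<Rightarrow> ('a \<Rightarrow> 'a) \<Rightarrow> bool" where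
  "DAT H u v w s b \<longleftrightarrow>
     permutable_triple H u v w s b \<and>
     (\<forall>x \<in> {u, v, w}. invertible_pair H (s x) (b x))"

text \<open>With \<open>P = S x\<close> and \<open>Q = B y x\<close> this is the associated walk $P(x;y)$.\<close>

definition paired_walk :: "'a owalk \<Rightarrow> 'a owalk \<Rightarrow> ('a \<times> 'a) vwalk" where
  "paired_walk P Q = zip (fst P) (fst Q)"

end

theory Submission
  imports Defs
begin

text \<open>Reversing all arcs and swapping coordinates maps \<open>H\<^sup>+\<close> to itself, so
  \<open>(x, z) \<rightarrow>\<^sup>* (s x, b x)\<close> yields \<open>(b x, s x) \<rightarrow>\<^sup>* (z, x)\<close> for \<open>z \<noteq> x\<close>. As \<open>(s x, b x)\<close> is
  invertible, this gives \<open>(x, y) \<rightarrow>\<^sup>* (s x, b x) \<rightarrow>\<^sup>* (b x, s x) \<rightarrow>\<^sup>* (z, x)\<close> for all \<open>y, z \<noteq> x\<close>.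
  With \<open>x\<close> ranging over the triple, all these pairs lie in one strong component, and any walk with
  both ends in a strong component stays inside it; so every choice of walks works.\<close>

text \<open>Indexing the arcs by position lets them be compared with \<open>owalk\<close> and
  \<open>avoids\<close>, which are stated index by index.\<close>

lemma vwalk_arcs_conv_nth:
  "set (vwalk_arcs p) = {(p ! i, p ! Suc i) | i. Suc i < length p}"
proof (induction p rule: vwalk_arcs.induct)
  case (3 x y xs)
  \<comment> \<open>Position \<open>0\<close> is the arc from \<open>x\<close> to \<open>y\<close>;
    the positions \<open>Suc i\<close> are those of the tail, covered by the induction
    hypothesis.\<close>
  have "(\<exists>i. Q i) \<longleftrightarrow> Q 0 \<or> (\<exists>i. Q (Suc i))" for Q :: "nat \<Rightarrow> bool"
    by (metis not0_implies_Suc)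
  from this[of "\<lambda>i. p = ((x # y # xs) ! i, (x # y # xs) ! Suc i) \<and> Suc i < length (x # y # xs)" for p]
  show ?case using 3 by (auto simp: set_eq_iff)
qed auto

lemma vwalk_reachable_hd_last:
  assumes "wf_digraph G" "vwalk p G" "x \<in> set p"
  shows "hd p \<rightarrow>\<^sup>*\<^bsub>G\<^esub> x \<and> x \<rightarrow>\<^sup>*\<^bsub>G\<^esub> last p"
  using assms(2,3)
proof (induction p arbitrary: x)
  case (Base u)
  then show ?case using assms(1) by (simp add: wf_digraph.reachable_refl)
next
  case (Cons u v es)
  interpret wf_digraph G by fact
  have "v \<rightarrow>\<^sup>*\<^bsub>G\<^esub> last (v # es)" using Cons.IH[of v] by simp
  with Cons show ?case
    by (auto intro: adj_reachable_trans reachable_refl adj_in_verts)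
qed

text \<open>Strong components are convex: each vertex of \<open>p\<close> is reachable from
  \<open>hd p\<close>, hence from \<open>a\<close>, and reaches \<open>last p\<close>, hence
  \<open>a\<close>.\<close>

lemma vwalk_induce_scc_of:
  assumes "wf_digraph G" "vwalk p G"
    and "hd p \<in> pre_digraph.scc_of G a" "last p \<in> pre_digraph.scc_of G a"
  shows "vwalk p (G \<restriction> pre_digraph.scc_of G a)"
proof -
  interpret wf_digraph G by fact
  have sub: "set p \<subseteq> scc_of a"
    using vwalk_reachable_hd_last[OF assms(1,2)] assms(3,4)
    by (auto simp: scc_of_def intro: reachable_trans)
  have "(p ! i, p ! Suc i) \<in> arcs_ends (G \<restriction> scc_of a)" if "Suc i < length p" for i
  proof -
    have "(p ! i, p ! Suc i) \<in> arcs_ends G"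
      using assms(2) that by (auto simp: vwalk_def vwalk_arcs_conv_nth)
    moreover have "p ! i \<in> scc_of a" "p ! Suc i \<in> scc_of a"
      using sub that by (auto simp: subset_iff)
    ultimately show ?thesis by (auto simp: arcs_ends_conv induce_subgraph_def)
  qed
  then show ?thesis
    using sub assms(2) by (auto simp: vwalk_def vwalk_arcs_conv_nth)
qed

lemma pair_wf_plus_digraph:
  assumes "pair_wf_digraph H"
  shows "pair_wf_digraph (plus_digraph H)"
proof -
  interpret pair_wf_digraph H by fact
  show ?thesis
    by unfold_locales (auto simp: plus_digraph_def dest: wellformed')
qed

text \<open>The two alternatives in the definition of an arc are the cases \<open>Forward\<close>
  and \<open>Backward\<close> of one condition, which is what a single step of two congruent walks
  has to satisfy for avoidance.\<close>

lemma plus_digraph_arc_iff_step: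
  "((x, y), (x', y')) \<in> parcs (plus_digraph H) \<longleftrightarrow>
     (\<exists>d. is_step H d x x' \<and> is_step H d y y' \<and> \<not> is_step H d x y')"
proof -
  have "(\<exists>d. Q d) \<longleftrightarrow> Q Forward \<or> Q Backward" for Q
    by (metis step.exhaust)
  then show ?thesis by (simp add: plus_digraph_def is_step_def)
qed

text \<open>Reversing the arc and swapping coordinates exchanges the two alternatives in the
  definition of an arc.\<close>

lemma plus_digraph_arc_swap:
  "(p, q) \<in> parcs (plus_digraph H) \<Longrightarrow> (prod.swap q, prod.swap p) \<in> parcs (plus_digraph H)"
  by (auto simp: plus_digraph_def)

lemma plus_digraph_reachable_swap:
  assumes "pair_wf_digraph H" "p \<rightarrow>\<^sup>*\<^bsub>plus_digraph H\<^esub> q"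
  shows "prod.swap q \<rightarrow>\<^sup>*\<^bsub>plus_digraph H\<^esub> prod.swap p"
proof -
  interpret plus: pair_wf_digraph "plus_digraph H"
    using assms(1) by (rule pair_wf_plus_digraph)
  from assms(2) show ?thesis
  proof (induction rule: plus.reachable_induct)
    case base
    then have "prod.swap p \<in> pverts (plus_digraph H)" by (auto simp: plus_digraph_def)
    then show ?case by simp
  next
    case (step x y)
    then show ?case
      \<comment> \<open>The last arc of the original path becomes the first arc of the reversed
        one.\<close>
      by (auto intro: plus.adj_reachable_trans plus_digraph_arc_swap)
  qed
qed

lemma paired_walk_hd_last:
  assumes "owalk_from_to H P x x'" "owalk_from_to H Q y y'" "congruent_walks P Q"
  shows "hd (paired_walk P Q) = (x, y)" "last (paired_walk P Q) = (x', y')"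
proof -
  have "length (fst P) = length (fst Q)" "fst P \<noteq> []" "fst Q \<noteq> []"
    using assms by (auto simp: owalk_from_to_def owalk_def congruent_walks_def)
  then show "hd (paired_walk P Q) = (x, y)" "last (paired_walk P Q) = (x', y')"
    using assms(1,2) by (simp_all add: paired_walk_def owalk_from_to_def hd_zip last_zip)
qed

text \<open>Congruence supplies one designation for both coordinates at each position, and avoidance
  supplies the missing arc.\<close>

lemma vwalk_paired_walk:
  assumes "owalk H P" "owalk H Q" "congruent_walks P Q" "avoids H P Q"
  shows "vwalk (paired_walk P Q) (plus_digraph H)"
proof (rule vwalkI)
  have len: "length (fst P) = Suc (length (snd P))" "length (fst Q) = Suc (length (snd P))"
    using assms by (auto simp: owalk_def congruent_walks_def)
  show "paired_walk P Q \<noteq> []" using len by (auto simp: paired_walk_def)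
  show "set (paired_walk P Q) \<subseteq> verts (plus_digraph H)"
    using assms(1,2)
    by (auto simp: paired_walk_def owalk_def plus_digraph_def dest: set_zip_leftD set_zip_rightD)
  show "set (vwalk_arcs (paired_walk P Q)) \<subseteq> arcs_ends (plus_digraph H)"
  proof -
    have "is_step H (snd P ! i) (fst P ! i) (fst P ! Suc i)"
      "is_step H (snd P ! i) (fst Q ! i) (fst Q ! Suc i)"
      "\<not> is_step H (snd P ! i) (fst P ! i) (fst Q ! Suc i)" if "i < length (snd P)" for i
      using that assms by (auto simp: owalk_def congruent_walks_def avoids_def)
    with len show ?thesis
      by (fastforce simp: vwalk_arcs_conv_nth paired_walk_def plus_digraph_arc_iff_step)
  qed
qed

lemma owalk_Cons:
  assumes "owalk_from_to H P y z" "is_step H d x y" "x \<in> pverts H"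
  shows "owalk_from_to H (x # fst P, d # snd P) x z"
proof -
  have "fst P \<noteq> []"
    using assms(1) by (auto simp: owalk_from_to_def owalk_def)
  moreover from this have "fst P ! 0 = y"
    using assms(1) by (simp add: owalk_from_to_def hd_conv_nth)
  ultimately show ?thesis using assms
    by (auto simp: owalk_from_to_def owalk_def nth_Cons split: nat.split)
qed

text \<open>Avoidance compares a vertex of the first walk with the next vertex of the second, so the
  new step only adds a condition on \<open>x\<close> and \<open>hd (fst Q)\<close>.\<close>

lemma avoids_Cons:
  assumes "avoids H P Q" "\<not> is_step H d x (hd (fst Q))" "fst Q \<noteq> []"
  shows "avoids H (x # fst P, d # snd P) (y # fst Q, d # snd Q)"
  using assms by (auto simp: avoids_def hd_conv_nth nth_Cons split: nat.splits)

text \<open>From right to left, the paired walk is a directed walk. From left to right, the two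
  walks are built from their common end backwards, each arc providing a designation for one new
  step.\<close>

lemma plus_digraph_reachable_iff:
  assumes "pair_wf_digraph H"
  shows "(x, y) \<rightarrow>\<^sup>*\<^bsub>plus_digraph H\<^esub> (x', y') \<longleftrightarrow>
    (\<exists>P Q. owalk_from_to H P x x' \<and> owalk_from_to H Q y y' \<and>
       congruent_walks P Q \<and> avoids H P Q)" (is "?L \<longleftrightarrow> ?R")
proof
  interpret plus: pair_wf_digraph "plus_digraph H"
    using assms by (rule pair_wf_plus_digraph)
  interpret pair_wf_digraph H by fact
  show ?L if ?R
  proof -
    from that obtain P Q where PQ: "owalk_from_to H P x x'" "owalk_from_to H Q y y'"
      "congruent_walks P Q" "avoids H P Q" by blast
    then have walk: "vwalk (paired_walk P Q) (plus_digraph H)"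
      by (intro vwalk_paired_walk) (auto simp: owalk_from_to_def)
    then have "last (paired_walk P Q) \<in> set (paired_walk P Q)"
      by (auto simp: vwalk_def)
    from vwalk_reachable_hd_last[OF plus.wf_digraph_axioms walk this] paired_walk_hd_last[OF PQ(1-3)]
    show ?thesis by simp
  qed
  \<comment> \<open>The start is a single variable \<open>p\<close>, as the induction on the start
    vertex requires.\<close>
  have "\<exists>P Q. owalk_from_to H P (fst p) x' \<and> owalk_from_to H Q (snd p) y' \<and>
     congruent_walks P Q \<and> avoids H P Q" if "p \<rightarrow>\<^sup>*\<^bsub>plus_digraph H\<^esub> (x', y')" for p
    using that
  proof (induction rule: plus.converse_reachable_induct)
    case base
    then have "owalk_from_to H ([x'], []) x' x'" "owalk_from_to H ([y'], []) y' y'"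
      "congruent_walks ([x'], []) ([y'], [])" "avoids H ([x'], []) ([y'], [])"
      by (auto simp: plus_digraph_def owalk_from_to_def owalk_def congruent_walks_def avoids_def)
    then show ?case unfolding fst_conv snd_conv by blast
  next
    case (step p q)
    obtain a b c e where pq: "p = (a, b)" "q = (c, e)" by fastforce
    with step obtain P Q where PQ: "owalk_from_to H P c x'" "owalk_from_to H Q e y'"
      "congruent_walks P Q" "avoids H P Q" by auto
    from step(1) pq obtain d where d: "is_step H d a c" "is_step H d b e" "\<not> is_step H d a e"
      by (auto simp: plus_digraph_arc_iff_step)
    have "a \<in> pverts H" "b \<in> pverts H"
      using d(1,2) by (auto simp: is_step_def split: step.splits dest: wellformed')
    moreover have "hd (fst Q) = e" "fst Q \<noteq> []"
      using PQ(2) by (auto simp: owalk_from_to_def owalk_def)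
    ultimately have "owalk_from_to H (a # fst P, d # snd P) a x'"
      "owalk_from_to H (b # fst Q, d # snd Q) b y'"
      "congruent_walks (a # fst P, d # snd P) (b # fst Q, d # snd Q)"
      "avoids H (a # fst P, d # snd P) (b # fst Q, d # snd Q)"
      using owalk_Cons[OF PQ(1) d(1)] owalk_Cons[OF PQ(2) d(2)] avoids_Cons[OF PQ(4)] d(3) PQ(3)
      by (simp_all add: congruent_walks_def)
    then show ?case unfolding pq fst_conv snd_conv by blast
  qed
  then show ?R if ?L using that by fastforce
qed

lemma invertible_pair_iff_reachable:
  assumes "pair_wf_digraph H"
  shows "invertible_pair H x y \<longleftrightarrow> x \<in> pverts H \<and> y \<in> pverts H \<and> x \<noteq> y \<and>
    (x, y) \<rightarrow>\<^sup>*\<^bsub>plus_digraph H\<^esub> (y, x) \<and> (y, x) \<rightarrow>\<^sup>*\<^bsub>plus_digraph H\<^esub> (x, y)"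
  unfolding invertible_pair_def plus_digraph_reachable_iff[OF assms] ..

theorem theorem3:
  fixes H :: "'a pair_pre_digraph" and u v w :: 'a and s b :: "'a \<Rightarrow> 'a"
  assumes "pair_fin_digraph H"
    and "DAT H u v w s b"
  shows "\<exists>S B C.
    triple_walks H u v w s b S B \<and>
    C \<in> pre_digraph.sccs (with_proj (plus_digraph H)) \<and>
    (\<forall>x \<in> {u, v, w}. \<forall>y \<in> {u, v, w} - {x}. vwalk (paired_walk (S x) (B y x)) C) \<and>
    invertible_pair H u v \<and> invertible_pair H u w \<and> invertible_pair H v w \<and>
    invertible_pair H (s u) (b u) \<and> invertible_pair H (s v) (b v) \<and>
    invertible_pair H (s w) (b w) \<and>
    {(u, v), (v, u), (u, w), (w, u), (v, w), (w, v),
     (s u, b u), (s v, b v), (s w, b w)} \<subseteq> verts C"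
proof -
  interpret pair_fin_digraph H by fact
  note wf = pair_wf_digraph_axioms
  interpret plus: pair_wf_digraph "plus_digraph H"
    using wf by (rule pair_wf_plus_digraph)
  let ?T = "{u, v, w}"
  let ?K = "with_proj (plus_digraph H)"
  \<comment> \<open>Any of the six pairs of distinct triple vertices would define the same
    component, by the fact \<open>all\<close> below.\<close>
  let ?C = "?K \<restriction> plus.scc_of (u, v)"
  from assms(2) obtain S B where SB: "triple_walks H u v w s b S B"
    and dist: "u \<noteq> v" "u \<noteq> w" "v \<noteq> w" and T: "?T \<subseteq> pverts H"
    and inv: "\<And>x. x \<in> ?T \<Longrightarrow> invertible_pair H (s x) (b x)"
    by (auto simp: DAT_def permutable_triple_def)
  have walks: "owalk_from_to H (S x) x (s x)" "owalk_from_to H (B y x) y (b x)"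
    "congruent_walks (S x) (B y x)" "avoids H (S x) (B y x)"
    if "x \<in> ?T" "y \<in> ?T" "x \<noteq> y" for x y
    using SB that unfolding triple_walks_def congruent_walks_def by auto
  have to_sb: "(x, y) \<rightarrow>\<^sup>*\<^bsub>?K\<^esub> (s x, b x)" if "x \<in> ?T" "y \<in> ?T" "x \<noteq> y" for x y
    unfolding plus_digraph_reachable_iff[OF wf] using walks[OF that] by blast
  have sb_bs: "(s x, b x) \<rightarrow>\<^sup>*\<^bsub>?K\<^esub> (b x, s x)" if "x \<in> ?T" for x
    using inv[OF that] by (simp add: invertible_pair_iff_reachable[OF wf])
  have from_sb: "(s x, b x) \<rightarrow>\<^sup>*\<^bsub>?K\<^esub> (z, x)" if "x \<in> ?T" "z \<in> ?T" "x \<noteq> z" for x z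
    using sb_bs[OF that(1)] plus_digraph_reachable_swap[OF wf to_sb[OF that]]
    by (auto intro: plus.reachable_trans)
  \<comment> \<open>Here \<open>y = z\<close> is allowed; that case is the fact
    \<open>swap\<close>.\<close>
  have step: "(x, y) \<rightarrow>\<^sup>*\<^bsub>?K\<^esub> (z, x)"
    if "x \<in> ?T" "y \<in> ?T" "z \<in> ?T" "x \<noteq> y" "x \<noteq> z" for x y z
    by (rule plus.reachable_trans[OF to_sb from_sb]) (use that in simp_all)
  have swap: "(x, y) \<rightarrow>\<^sup>*\<^bsub>?K\<^esub> (y, x)" if "x \<in> ?T" "y \<in> ?T" "x \<noteq> y" for x y
    using step[of x y y] that by blast
  have fst_eq: "(x, y) \<rightarrow>\<^sup>*\<^bsub>?K\<^esub> (x, z)"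
    if "x \<in> ?T" "y \<in> ?T" "z \<in> ?T" "x \<noteq> y" "x \<noteq> z" for x y z
    \<comment> \<open>The intermediate pair is \<open>(z, x)\<close>; for \<open>snd_eq\<close> it
      is \<open>(y, x)\<close>.\<close>
    by (rule plus.reachable_trans[OF step swap]) (use that in simp_all)
  have snd_eq: "(x, y) \<rightarrow>\<^sup>*\<^bsub>?K\<^esub> (z, y)"
    if "x \<in> ?T" "y \<in> ?T" "z \<in> ?T" "x \<noteq> y" "y \<noteq> z" for x y z
    by (rule plus.reachable_trans[OF swap step]) (use that in simp_all)
  have all: "(x, y) \<rightarrow>\<^sup>*\<^bsub>?K\<^esub> (x', y')"
    if "x \<in> ?T" "y \<in> ?T" "x \<noteq> y" "x' \<in> ?T" "y' \<in> ?T" "x' \<noteq> y'" for x y x' y'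
  \<comment> \<open>Coordinates are changed one at a time through \<open>(x, y')\<close>, which
    needs \<open>x \<noteq> y'\<close>. If \<open>x = y'\<close>, the fact \<open>step\<close> gives
    the claim at once.\<close>
  proof (cases "x = y'")
    case True
    then show ?thesis using step[of x y x'] that by auto
  next
    case False
    show ?thesis
      by (rule plus.reachable_trans[OF fst_eq snd_eq]) (use that False in simp_all)
  qed
  have pair_mem: "(x, y) \<in> plus.scc_of (u, v)" if "x \<in> ?T" "y \<in> ?T" "x \<noteq> y" for x y
    using all[of u v x y] all[of x y u v] that dist by (simp add: plus.scc_of_def)
  have sb_mem: "(s x, b x) \<in> plus.scc_of (u, v)" if x: "x \<in> ?T" for x
  proof -
    obtain y where y: "y \<in> ?T" "x \<noteq> y" using dist by blast
    \<comment> \<open>The way into \<open>(s x, b x)\<close> starts at \<open>(x, y)\<close>, but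
      the way out ends at the swapped pair \<open>(y, x)\<close>; both pairs are linked to
      \<open>(u, v)\<close>.\<close>
    have "(u, v) \<rightarrow>\<^sup>*\<^bsub>?K\<^esub> (x, y)" "(y, x) \<rightarrow>\<^sup>*\<^bsub>?K\<^esub> (u, v)"
      using all[of u v x y] all[of y x u v] x y dist by auto
    from plus.reachable_trans[OF this(1) to_sb[OF x y]]
      plus.reachable_trans[OF from_sb[OF x y] this(2)] show ?thesis by (simp add: plus.scc_of_def)
  qed
  have "(u, v) \<in> pverts (plus_digraph H)"
    using T by (auto simp: plus_digraph_def)
  \<comment> \<open>\<open>scc_of\<close> is a vertex set, whereas \<open>sccs\<close> consists of
    subgraphs, so the component is the subgraph induced on that set.\<close>
  then have "?C \<in> plus.sccs"
    using plus.scc_of_in_sccs_verts plus.in_verts_sccsD_sccs by blast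
  moreover have "vwalk (paired_walk (S x) (B y x)) ?C"
    if "x \<in> ?T" "y \<in> ?T - {x}" for x y
  proof -
    have y: "y \<in> ?T" "x \<noteq> y" using that by auto
    note W = walks[OF that(1) y]
    have "vwalk (paired_walk (S x) (B y x)) ?K"
      using W by (intro vwalk_paired_walk) (auto simp: owalk_from_to_def)
    then show ?thesis
      using paired_walk_hd_last[OF W(1-3)] pair_mem[OF that(1) y] sb_mem[OF that(1)]
      by (intro vwalk_induce_scc_of) (simp_all add: plus.wf_digraph_axioms)
  qed
  moreover have "invertible_pair H x y" if "x \<in> ?T" "y \<in> ?T" "x \<noteq> y" for x y
    using swap[of x y] swap[of y x] that T
    by (auto simp: invertible_pair_iff_reachable[OF wf])
  then have "invertible_pair H u v \<and> invertible_pair H u w \<and> invertible_pair H v w"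
    using dist by simp
  moreover have "{(u, v), (v, u), (u, w), (w, u), (v, w), (w, v),
     (s u, b u), (s v, b v), (s w, b w)} \<subseteq> verts ?C"
    using pair_mem sb_mem dist by simp
  ultimately show ?thesis
    \<comment> \<open>The witnesses \<open>S\<close> and \<open>B\<close> are the walks given by the
      permutable triple, unchanged.\<close>
    using SB inv by (intro exI[of _ S] exI[of _ B] exI[of _ ?C]) simp
qed

end
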